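(* Let $n$ be a positive integer and let $G = (G_1, G_2, G_3)$ be a graph triple with $G_1=(V_1,E_1)$, $G_2=(V_2,E_2)$, $G_3=(V_1\cup V_2,E_3)$ and $|V_1| = |V_2| = n$. If $\Delta(G_1)\Delta(G_2) + \Delta(G_3) \leq n/2$, then $G$ does not pack if and only if $\Delta(G_3) = 0$ and one of $G_1$ or $G_2$ is a perfect matching and the other either is $K_{\frac{n}{2},\frac{n}{2}}$ with $\frac{n}{2}$ odd or contains $K_{\frac{n}{2}+1}$. Consequently, if $\Delta(G_1)\Delta(G_2) + \Delta(G_3) < n/2$, then $G$ packs.
   Context: All graphs are finite and simple. A graph triple $(G_1,G_2,G_3)$ of size $n$ consists of two $n$-vertex graphs $G_1=(V_1,E_1)$ and $G_2=(V_2,E_2)$ on disjoint vertex sets, together with a bipartite graph $G_3=(V_1\cup V_2,E_3)$ with partite sets $V_1$ and $V_2$ (so every edge of $E_3$ joins a vertex of $V_1$ to a vertex of $V_2$). The triple packs if there is a bijection $f:V_1\to V_2$ such that $uv\in E_1$ implies $f(u)f(v)\notin E_2$, and $uf(u)\notin E_3$ for every $u\in V_1$. $\Delta(H)$ denotes the maximum degree of a graph $H$; in particular $\Delta(G_3)$ is the maximum of the $G_3$-degrees over all vertices of $V_1\cup V_2$. An $n$-vertex graph "is a perfect matching" if it is 1-regular (so $n$ is even); "contains $K_m$" means it has a complete subgraph on $m$ vertices. *)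

theory Defs
  imports Complex_Main
begin

text \<open>A graph is a pair of a vertex set and a set of edges, each edge being an unordered pair
  of distinct vertices.\<close>

type_synonym 'a graph = "'a set \<times> 'a set set"

abbreviation verts :: "'a graph \<Rightarrow> 'a set" where
  "verts \<equiv> fst"

abbreviation edges :: "'a graph \<Rightarrow> 'a set set" where
  "edges \<equiv> snd"

definition finite_simple_graph :: "'a graph \<Rightarrow> bool" where
  "finite_simple_graph G \<longleftrightarrow>
     finite (verts G) \<and> (\<forall>e\<in>edges G. e \<subseteq> verts G \<and> card e = 2)"

definition degree :: "'a graph \<Rightarrow> 'a \<Rightarrow> nat" where
  "degree G v = card {e \<in> edges G. v \<in> e}"

text \<open>Meaningful only for a finite nonempty vertex set.\<close>

definition max_degree :: "'a graph \<Rightarrow> nat" where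
  "max_degree G = Max (degree G ` verts G)"

definition bipartite_with :: "'a set \<Rightarrow> 'a set \<Rightarrow> 'a graph \<Rightarrow> bool" where
  "bipartite_with A B G \<longleftrightarrow>
     verts G = A \<union> B \<and> A \<inter> B = {} \<and> (\<forall>e\<in>edges G. \<exists>a\<in>A. \<exists>b\<in>B. e = {a, b})"

definition graph_triple :: "nat \<Rightarrow> 'a graph \<Rightarrow> 'a graph \<Rightarrow> 'a graph \<Rightarrow> bool" where
  "graph_triple n G1 G2 G3 \<longleftrightarrow>
     finite_simple_graph G1 \<and> finite_simple_graph G2 \<and> finite_simple_graph G3 \<and>
     card (verts G1) = n \<and> card (verts G2) = n \<and>
     verts G1 \<inter> verts G2 = {} \<and> bipartite_with (verts G1) (verts G2) G3"

definition packs :: "'a graph \<Rightarrow> 'a graph \<Rightarrow> 'a graph \<Rightarrow> bool" where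
  "packs G1 G2 G3 \<longleftrightarrow>
     (\<exists>f. bij_betw f (verts G1) (verts G2) \<and>
          (\<forall>u\<in>verts G1. \<forall>v\<in>verts G1. {u, v} \<in> edges G1 \<longrightarrow> {f u, f v} \<notin> edges G2) \<and>
          (\<forall>u\<in>verts G1. {u, f u} \<notin> edges G3))"

definition is_perfect_matching :: "'a graph \<Rightarrow> bool" where
  "is_perfect_matching G \<longleftrightarrow> (\<forall>v\<in>verts G. degree G v = 1)"

definition is_complete_bipartite :: "nat \<Rightarrow> nat \<Rightarrow> 'a graph \<Rightarrow> bool" where
  "is_complete_bipartite k l G \<longleftrightarrow>
     (\<exists>A B. verts G = A \<union> B \<and> A \<inter> B = {} \<and> card A = k \<and> card B = l \<and>
            edges G = {{a, b} | a b. a \<in> A \<and> b \<in> B})"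

definition contains_complete :: "nat \<Rightarrow> 'a graph \<Rightarrow> bool" where
  "contains_complete m G \<longleftrightarrow>
     (\<exists>K\<subseteq>verts G. card K = m \<and> (\<forall>u\<in>K. \<forall>v\<in>K. u \<noteq> v \<longrightarrow> {u, v} \<in> edges G))"

text \<open>A perfect matching has an even number \<open>n\<close> of vertices, so \<open>n div 2\<close> below is exactly half
  of \<open>n\<close> whenever the predicate holds for graphs on \<open>n\<close> vertices.\<close>

definition extremal_pair :: "nat \<Rightarrow> 'a graph \<Rightarrow> 'a graph \<Rightarrow> bool" where
  "extremal_pair n G H \<longleftrightarrow>
     is_perfect_matching G \<and>
     (is_complete_bipartite (n div 2) (n div 2) H \<and> odd (n div 2) \<or>
      contains_complete (n div 2 + 1) H)"

end

theory Submission
  imports Defs "HOL-Combinatorics.Permutations"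
begin

text \<open>A bijection \<open>f\<close> lays \<open>G2\<close> over \<open>G1\<close> on the vertex set of \<open>G1\<close>: call the edges of \<open>G1\<close>
  red and those of the pulled back \<open>G2\<close> blue. Then \<open>f\<close> is a packing iff there is no double edge (red
  and blue) and no loop (a vertex joined to its own image by \<open>G3\<close>). Take \<open>f\<close> with as few double edges
  and loops as possible and exchange the images of two vertices \<open>u\<close> and \<open>w\<close>. This destroys every
  clash at \<open>u\<close> and \<open>w\<close> (except that an edge \<open>uw\<close> stays as it is) and creates one clash for each red-blue
  or blue-red path of length two from \<open>u\<close> to \<open>w\<close>, and one for each edge of \<open>G3\<close> from \<open>u\<close> or \<open>w\<close> to
  the image of the other. In all, \<open>u\<close> has at most \<open>2 \<Delta>1 \<Delta>2 + 2 \<Delta>3 \<le> n\<close> such links. Comparing, over all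
  \<open>w\<close>, the links with the clashes that the swap removes leaves no room at all if \<open>u\<close> lies in a clash
  (lemma \<open>clash_tight\<close>): there is then a single double edge \<open>uv\<close> and no loop, every vertex other than
  \<open>u\<close> and \<open>v\<close> is linked to \<open>u\<close> exactly once, \<open>v\<close> is not linked to \<open>u\<close>, and all degrees near \<open>u\<close>
  are maximal.

  Hence exchanging the images of \<open>u\<close> and any \<open>w\<close> other than \<open>v\<close> gives another optimal bijection
  with a single clash, to which the same conclusions apply (lemma \<open>swap_optimal\<close>). All the rest comes
  from this. If \<open>w\<close> were linked to \<open>u\<close> by \<open>G3\<close>, the new clash would be a loop; so \<open>\<Delta>3 = 0\<close>.
  If \<open>\<Delta>1, \<Delta>2 \<ge> 2\<close>, swaps show that \<open>u\<close> and \<open>v\<close> have the same red neighbours and the same blue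
  neighbours, apart from each other, that the same holds around other edges, and that this is
  contradictory (lemma \<open>no_conf\<close>). If \<open>\<Delta>1 = 1\<close>, red is a perfect matching and each blue neighbour of
  \<open>v\<close> other than \<open>u\<close> is a blue twin of \<open>u\<close>, adjacent or not (lemma \<open>matching_blue_twins\<close>); adjacent twins
  give a clique on \<open>n/2 + 1\<close> vertices and nonadjacent twins give the complete bipartite graph
  (lemma \<open>matching_extremal\<close>). The case \<open>\<Delta>2 = 1\<close> is the same with the colours exchanged.

  Conversely the extremal pairs do not pack, because an independent set of a perfect matching has at
  most \<open>n/2\<close> vertices, and an odd set is not a union of matching edges
  (lemma \<open>extremal_pair_not_packs\<close>).\<close>

section \<open>Overlaid graphs and swaps\<close>

text \<open>Twice the number of double edges and loops: the first sum runs over ordered pairs.\<close>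
definition overlap :: "'a set \<Rightarrow> ('a \<Rightarrow> 'a \<Rightarrow> bool) \<Rightarrow> ('a \<Rightarrow> 'a \<Rightarrow> bool) \<Rightarrow> ('a \<Rightarrow> 'a \<Rightarrow> bool) \<Rightarrow> nat"
  where "overlap V R B Y =
    (\<Sum>x\<in>V. \<Sum>y\<in>V. of_bool (R x y \<and> B x y)) + 2 * (\<Sum>x\<in>V. of_bool (Y x x))"

lemma sum_remove_two:
  fixes f :: "'a \<Rightarrow> nat"
  assumes "finite V" "u \<in> V" "w \<in> V" "u \<noteq> w"
  shows "sum f V = f u + f w + sum f (V - {u, w})"
proof -
  have "sum f V = f u + sum f (V - {u})" using assms by (simp add: sum.remove)
  also have "sum f (V - {u}) = f w + sum f (V - {u} - {w})" using assms by (simp add: sum.remove)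
  also have "V - {u} - {w} = V - {u, w}" by auto
  finally show ?thesis by simp
qed

lemma double_sum_remove_two:
  fixes g :: "'a \<Rightarrow> 'a \<Rightarrow> nat"
  assumes "finite V" "u \<in> V" "w \<in> V" "u \<noteq> w"
    and "\<And>x y. g x y = g y x" "\<And>x. g x x = 0"
  shows "(\<Sum>x\<in>V. \<Sum>y\<in>V. g x y) =
    (\<Sum>x\<in>V - {u, w}. \<Sum>y\<in>V - {u, w}. g x y)
    + 2 * (\<Sum>y\<in>V - {u, w}. g u y) + 2 * (\<Sum>y\<in>V - {u, w}. g w y) + 2 * g u w"
proof -
  have "(\<Sum>x\<in>V - {u, w}. \<Sum>y\<in>V. g x y) =
     (\<Sum>x\<in>V - {u, w}. g u x + g w x + (\<Sum>y\<in>V - {u, w}. g x y))"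
    by (rule sum.cong[OF refl], subst sum_remove_two[OF assms(1-4)]) (metis assms(5))
  then show ?thesis
    using assms(5)[of w u]
    by (simp add: sum_remove_two[OF assms(1-4)] sum.distrib assms(6))
qed

text \<open>Exchanging the images of \<open>u\<close> and \<open>w\<close> exchanges their blue neighbourhoods; \<open>R\<close> stays in place.\<close>
definition swap_blue :: "'a \<Rightarrow> 'a \<Rightarrow> ('a \<Rightarrow> 'a \<Rightarrow> bool) \<Rightarrow> 'a \<Rightarrow> 'a \<Rightarrow> bool"
  where "swap_blue u w B x y \<longleftrightarrow> B (transpose u w x) (transpose u w y)"

text \<open>\<open>R\<close> and \<open>B\<close> are the red and the blue edges on \<open>V\<close>, and \<open>Y x y\<close> says that \<open>x\<close> may not be
  sent to the image of \<open>y\<close>. So \<open>Y\<close> is not symmetric, and both its degrees are bounded.\<close>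
locale overlay =
  fixes V :: "'a set" and R B Y :: "'a \<Rightarrow> 'a \<Rightarrow> bool" and d1 d2 d3 :: nat
  assumes finV: "finite V"
    and R_V: "R x y \<Longrightarrow> x \<in> V"
    and R_sym: "R x y \<Longrightarrow> R y x"
    and R_irrefl: "\<not> R x x"
    and B_V: "B x y \<Longrightarrow> x \<in> V"
    and B_sym: "B x y \<Longrightarrow> B y x"
    and B_irrefl: "\<not> B x x"
    and Y_V: "Y x y \<Longrightarrow> x \<in> V \<and> y \<in> V"
    and R_deg: "card {y. R x y} \<le> d1"
    and B_deg: "card {y. B x y} \<le> d2"
    and Y_deg: "card {y. Y x y} \<le> d3"
    and Y_deg': "card {x. Y x y} \<le> d3"
    and small: "2 * (d1 * d2 + d3) \<le> card V"
begin

abbreviation conf where "conf x y \<equiv> R x y \<and> B x y"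

text \<open>\<open>clash x\<close> counts the conflicts at \<open>x\<close>, and \<open>link u w\<close> those that appear at \<open>u\<close> or \<open>w\<close> when their
  images are exchanged, apart from a double edge between \<open>u\<close> and \<open>w\<close>.\<close>
definition clash :: "'a \<Rightarrow> nat" where
  "clash x = (\<Sum>y\<in>V. of_bool (conf x y)) + of_bool (Y x x)"

definition link :: "'a \<Rightarrow> 'a \<Rightarrow> nat" where
  "link u w = (\<Sum>x\<in>V. of_bool (R u x \<and> B x w)) + (\<Sum>x\<in>V. of_bool (B u x \<and> R x w))
     + of_bool (Y u w) + of_bool (Y w u)"

text \<open>A red-blue path from \<open>u\<close> over \<open>x\<close> to \<open>w\<close> becomes a double edge \<open>ux\<close> once \<open>u\<close> has the blue
  neighbours of \<open>w\<close>, and a blue-red path becomes a double edge \<open>wx\<close>. A double edge \<open>uw\<close> is counted by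
  both clash terms although it survives the swap; the last summand corrects this.\<close>
lemma overlap_swap:
  assumes "u \<in> V" "w \<in> V" "u \<noteq> w"
  shows "overlap V R (swap_blue u w B) (\<lambda>x y. Y x (transpose u w y)) + 2 * (clash u + clash w)
       = overlap V R B Y + 2 * link u w + 4 * of_bool (conf u w)"
proof -
  note rm = sum_remove_two[OF finV assms] and rm2 = double_sum_remove_two[OF finV assms]
  let ?W = "V - {u, w}"
  define g :: "'a \<Rightarrow> 'a \<Rightarrow> nat" where "g x y = of_bool (conf x y)" for x y
  define g' :: "'a \<Rightarrow> 'a \<Rightarrow> nat" where "g' x y = of_bool (R x y \<and> swap_blue u w B x y)" for x y
  have gs: "g x y = g y x" for x y
    using R_sym[of x y] R_sym[of y x] B_sym[of x y] B_sym[of y x] by (auto simp: g_def of_bool_def)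
  have g0: "g x x = 0" for x using R_irrefl by (simp add: g_def)
  have g's: "g' x y = g' y x" for x y
    using R_sym[of x y] R_sym[of y x] B_sym by (auto simp: g'_def swap_blue_def of_bool_def)
  have g'0: "g' x x = 0" for x using R_irrefl by (simp add: g'_def)
  have W: "g' x y = g x y" if "x \<in> ?W" "y \<in> ?W" for x y
    using that by (simp add: g_def g'_def swap_blue_def)
  have uw: "g' u w = g u w" using B_sym by (auto simp: g_def g'_def swap_blue_def)
  have lu: "(\<Sum>x\<in>V. of_bool (R u x \<and> B x w)) = (\<Sum>x\<in>?W. g' u x)"
    unfolding rm using R_irrefl B_irrefl B_sym
    by (auto simp: g'_def swap_blue_def intro!: sum.cong arg_cong[where f=of_bool])
  have lw: "(\<Sum>x\<in>V. of_bool (B u x \<and> R x w)) = (\<Sum>x\<in>?W. g' w x)"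
    unfolding rm using R_irrefl B_irrefl R_sym
    by (auto simp: g'_def swap_blue_def intro!: sum.cong arg_cong[where f=of_bool])
  have cu: "clash u = (\<Sum>x\<in>?W. g u x) + g u w + of_bool (Y u u)"
    unfolding clash_def rm using g0[of u] by (simp add: g_def)
  have cw: "clash w = (\<Sum>x\<in>?W. g w x) + g u w + of_bool (Y w w)"
    unfolding clash_def rm using g0[of w] gs[of u w] by (simp add: g_def)
  have o: "overlap V R B Y = (\<Sum>x\<in>?W. \<Sum>y\<in>?W. g x y) + 2 * (\<Sum>y\<in>?W. g u y)
     + 2 * (\<Sum>y\<in>?W. g w y) + 2 * g u w
     + 2 * (of_bool (Y u u) + of_bool (Y w w) + (\<Sum>x\<in>?W. of_bool (Y x x)))"
    unfolding overlap_def rm[of "\<lambda>x. of_bool (Y x x)"] using rm2[of g, OF gs g0] by (simp add: g_def)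
  have "(\<Sum>x\<in>?W. of_bool (Y x (transpose u w x))) = (\<Sum>x\<in>?W. of_bool (Y x x) :: nat)"
    by (rule sum.cong) auto
  moreover have "(\<Sum>x\<in>?W. \<Sum>y\<in>?W. g' x y) = (\<Sum>x\<in>?W. \<Sum>y\<in>?W. g x y)"
    using W by (intro sum.cong) auto
  ultimately have o': "overlap V R (swap_blue u w B) (\<lambda>x y. Y x (transpose u w y)) =
       (\<Sum>x\<in>?W. \<Sum>y\<in>?W. g x y) + 2 * (\<Sum>y\<in>?W. g' u y)
     + 2 * (\<Sum>y\<in>?W. g' w y) + 2 * g u w
     + 2 * (of_bool (Y u w) + of_bool (Y w u) + (\<Sum>x\<in>?W. of_bool (Y x x)))"
    unfolding overlap_def rm[of "\<lambda>x. of_bool (Y x (transpose u w x))"] uw[symmetric]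
    using rm2[of g', OF g's g'0] by (simp add: g'_def)
  show ?thesis unfolding o o' cu cw link_def lu lw by (simp add: g_def)
qed

lemma R_V': "R x y \<Longrightarrow> y \<in> V" by (rule R_V[OF R_sym])

lemma B_V': "B x y \<Longrightarrow> y \<in> V" by (rule B_V[OF B_sym])

lemma nbrs: "{y. R x y} \<subseteq> V" "{y. B x y} \<subseteq> V" "{y. Y x y} \<subseteq> V" "{y. Y y x} \<subseteq> V"
  by (auto dest: R_V' B_V' Y_V)

lemma fin_nbrs: "finite {y. R x y}" "finite {y. B x y}" "finite {y. Y x y}" "finite {y. Y y x}"
  using nbrs finV finite_subset by metis+

lemma sum_of_bool_V:
  assumes "{x. P x} \<subseteq> V"
  shows "(\<Sum>x\<in>V. of_bool (P x) :: nat) = card {x. P x}"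
proof -
  have "(\<Sum>x\<in>V. of_bool (P x) :: nat) = card {x\<in>V. P x}"
    using finV by (simp add: of_bool_def sum.If_cases Int_def)
  also have "{x\<in>V. P x} = {x. P x}" using assms by auto
  finally show ?thesis .
qed

lemma sum_paths:
  assumes "\<And>x. {y. P x y} \<subseteq> V" "\<And>x. {y. Q x y} \<subseteq> V"
  shows "(\<Sum>w\<in>V. \<Sum>x\<in>V. of_bool (P u x \<and> Q x w) :: nat) = (\<Sum>x | P u x. card {y. Q x y})"
proof -
  have "(\<Sum>w\<in>V. \<Sum>x\<in>V. of_bool (P u x \<and> Q x w) :: nat) = (\<Sum>x\<in>V. \<Sum>w\<in>V. of_bool (P u x \<and> Q x w))"
    by (rule sum.swap)
  also have "\<dots> = (\<Sum>x\<in>V. if P u x then card {y. Q x y} else 0)"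
    by (intro sum.cong refl) (simp add: sum_of_bool_V[OF assms(2)])
  also have "\<dots> = (\<Sum>x\<in>{x\<in>V. P u x}. card {y. Q x y})"
    using finV by (simp add: sum.inter_filter)
  also have "{x\<in>V. P u x} = {x. P u x}" using assms(1) by auto
  finally show ?thesis .
qed

lemma sum_link:
  "(\<Sum>w\<in>V. link u w) = (\<Sum>x | R u x. card {y. B x y}) + (\<Sum>x | B u x. card {y. R x y})
     + card {y. Y u y} + card {y. Y y u}"
  unfolding link_def by (simp add: sum.distrib sum_paths nbrs sum_of_bool_V)

lemma sum_RB_le: "(\<Sum>x | R u x. card {y. B x y}) \<le> card {x. R u x} * d2"
    "(\<Sum>x | B u x. card {y. R x y}) \<le> card {x. B u x} * d1"
  using sum_bounded_above[of "{x. R u x}" "\<lambda>x. card {y. B x y}" d2]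
    sum_bounded_above[of "{x. B u x}" "\<lambda>x. card {y. R x y}" d1] R_deg B_deg by auto

lemma sum_link_parts:
  "(\<Sum>x | R u x. card {y. B x y}) \<le> d1 * d2" "(\<Sum>x | B u x. card {y. R x y}) \<le> d1 * d2"
  using sum_RB_le[of u] mult_le_mono1[OF R_deg[of u], of d2] mult_le_mono1[OF B_deg[of u], of d1]
    mult.commute[of d1 d2] by linarith+

lemma sum_link_le: "(\<Sum>w\<in>V. link u w) \<le> card V"
  using sum_link_parts[of u] Y_deg[of u] Y_deg'[of u] small sum_link[of u] by simp

lemma link_self: "link u u = 2 * clash u"
proof -
  have "(\<Sum>x\<in>V. of_bool (R u x \<and> B x u)) = (\<Sum>y\<in>V. of_bool (conf u y) :: nat)"
    "(\<Sum>x\<in>V. of_bool (B u x \<and> R x u)) = (\<Sum>y\<in>V. of_bool (conf u y) :: nat)"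
    using R_sym B_sym by (auto intro!: sum.cong arg_cong[where f=of_bool])
  then show ?thesis unfolding link_def clash_def by simp
qed

end

section \<open>Optimal overlays have at most one conflict\<close>
locale optimal_overlay = overlay +
  assumes optimal: "p permutes V \<Longrightarrow>
    overlap V R B Y \<le> overlap V R (\<lambda>x y. B (p x) (p y)) (\<lambda>x y. Y x (p y))"
begin

lemma clash_le_link:
  assumes "u \<in> V" "w \<in> V" "u \<noteq> w"
  shows "clash u + clash w \<le> link u w + 2 * of_bool (conf u w)"
proof -
  have "overlap V R B Y \<le> overlap V R (swap_blue u w B) (\<lambda>x y. Y x (transpose u w y))"
    unfolding swap_blue_def by (rule optimal) (rule permutes_swap_id[OF assms(1,2)])
  then show ?thesis using overlap_swap[OF assms] by simp
qed

text \<open>Sum \<open>clash_le_link\<close> over all \<open>w \<noteq> u\<close> and add the \<open>2 * clash u\<close> links from \<open>u\<close> to itself. With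
  \<open>n = card V\<close>, \<open>k = clash u\<close>, \<open>N\<close> the sum of the clashes elsewhere and \<open>f\<close> the number of double edges
  at \<open>u\<close>, this and the bound \<open>n\<close> on the number of links give
  \<open>(n + 1) k + N \<le> n + 2 f\<close>. Since \<open>f \<le> N\<close> and \<open>f \<le> k\<close>, a positive \<open>k\<close> forces
  \<open>k = f = N = 1\<close>, with equality in every estimate.\<close>
lemma clash_tight:
  assumes u: "u \<in> V" and pos: "clash u > 0"
  shows "clash u = 1" "\<not> Y u u" "(\<Sum>y\<in>V. of_bool (conf u y) :: nat) = 1"
    "(\<Sum>w\<in>V - {u}. clash w) = 1"
    "(\<Sum>w\<in>V. link u w) = card V"
    "w \<in> V \<Longrightarrow> w \<noteq> u \<Longrightarrow> link u w + 2 * of_bool (conf u w) = 1 + clash w"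
proof -
  define f :: nat where "f = (\<Sum>y\<in>V. of_bool (conf u y))"
  define N where "N = (\<Sum>w\<in>V - {u}. clash w)"
  define n where "n = card V"
  have n: "n > 0" using u finV unfolding n_def by (auto simp: card_gt_0_iff)
  have f': "f = (\<Sum>y\<in>V - {u}. of_bool (conf u y))"
    unfolding f_def using sum.remove[OF finV u, of "\<lambda>y. of_bool (conf u y) :: nat"] R_irrefl by simp
  have "of_bool (conf u y) \<le> clash y" if "y \<in> V" for y
  proof (cases "conf u y")
    case True
    then have "(of_bool (conf y u) :: nat) \<le> (\<Sum>z\<in>V. of_bool (conf y z))"
      using finV u by (intro member_le_sum) auto
    with True R_sym[of u y] B_sym[of u y] show ?thesis unfolding clash_def by simp
  qed auto
  then have fN: "f \<le> N" unfolding f' N_def by (intro sum_mono) auto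
  have fk: "clash u = f + of_bool (Y u u)" unfolding clash_def f_def ..
  have L: "(\<Sum>w\<in>V. link u w) = 2 * clash u + (\<Sum>w\<in>V - {u}. link u w)"
    using sum.remove[OF finV u, of "link u"] link_self[of u] by simp
  have le: "clash u + clash w \<le> link u w + 2 * of_bool (conf u w)" if "w \<in> V - {u}" for w
    by (rule clash_le_link[OF u]) (use that in auto)
  have s1: "(\<Sum>w\<in>V - {u}. clash u + clash w) = (n - 1) * clash u + N"
    using u finV by (simp add: sum.distrib N_def n_def)
  have s2: "(\<Sum>w\<in>V - {u}. link u w + 2 * of_bool (conf u w)) = (\<Sum>w\<in>V - {u}. link u w) + 2 * f"
    by (simp only: sum.distrib f' sum_distrib_left)
  have low: "(n - 1) * clash u + N \<le> (\<Sum>w\<in>V - {u}. link u w) + 2 * f"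
    unfolding s1[symmetric] s2[symmetric] by (rule sum_mono, rule le)
  moreover have nk: "n * clash u = (n - 1) * clash u + clash u" using n by (cases n) auto
  moreover have up: "(\<Sum>w\<in>V - {u}. link u w) + 2 * clash u \<le> n"
    using sum_link_le[of u] L unfolding n_def by simp
  ultimately have key: "n * clash u + clash u + N \<le> n + 2 * f" by linarith
  have "f \<le> clash u" using fk by simp
  then have "n * clash u \<le> n * 1" using key fN by linarith
  then have k1: "clash u = 1" using n pos by simp
  then have fN1: "f = 1" "N = 1" using key fN fk by (auto simp: of_bool_def split: if_splits)
  show "clash u = 1" by fact
  show "\<not> Y u u" using fk k1 fN1 by (auto simp: of_bool_def split: if_splits)
  show "(\<Sum>y\<in>V. of_bool (conf u y) :: nat) = 1" using fN1 unfolding f_def by simp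
  show "(\<Sum>w\<in>V - {u}. clash w) = 1" using fN1 unfolding N_def by simp
  have "n - 1 + 1 \<le> (\<Sum>w\<in>V - {u}. link u w) + 2" using low k1 fN1 by simp
  then show "(\<Sum>w\<in>V. link u w) = card V"
    using L k1 fN1 up sum_link_le[of u] n unfolding n_def[symmetric] by linarith
  show "link u w + 2 * of_bool (conf u w) = 1 + clash w" if "w \<in> V" "w \<noteq> u"
  proof (rule ccontr)
    assume neq: "link u w + 2 * of_bool (conf u w) \<noteq> 1 + clash w"
    have "(\<Sum>w\<in>V - {u}. clash u + clash w) < (\<Sum>w\<in>V - {u}. link u w + 2 * of_bool (conf u w))"
    proof (rule sum_strict_mono_ex1)
      show "\<exists>w\<in>V - {u}. clash u + clash w < link u w + 2 * of_bool (conf u w)"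
        using neq le[of w] that k1 by (intro bexI[of _ w]) auto
    qed (use finV in simp, blast intro: le)
    then show False using s1 s2 fN1 k1 up n by simp
  qed
qed

lemma sum_of_bool_eq_1D:
  assumes "finite A" "(\<Sum>y\<in>A. of_bool (P y) :: nat) = 1" "x \<in> A" "P x" "y \<in> A" "P y"
  shows "x = y"
proof -
  have "(\<Sum>y\<in>A. of_bool (P y) :: nat) = card {y\<in>A. P y}"
    using assms(1) by (simp add: of_bool_def sum.If_cases Int_def)
  then have "card {y\<in>A. P y} = 1" using assms(2) by simp
  then obtain z where "{y\<in>A. P y} = {z}" by (rule card_1_singletonE)
  then have "x \<in> {z}" "y \<in> {z}" using assms(3-6) by blast+
  then show ?thesis by simp
qed

lemma conf_sym: "conf x y \<Longrightarrow> conf y x"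
  using R_sym B_sym by blast

lemma clash_conf: "conf x y \<Longrightarrow> clash x > 0"
proof -
  assume c: "conf x y"
  then have "y \<in> V" using R_V' by blast
  then have "of_bool (conf x y) \<le> (\<Sum>z\<in>V. of_bool (conf x z) :: nat)"
    using finV by (intro member_le_sum) auto
  then show ?thesis using c by (simp add: clash_def)
qed

lemma no_loop: "\<not> Y x x"
proof
  assume "Y x x"
  then have "x \<in> V" "clash x > 0" using Y_V by (auto simp: clash_def)
  then show False using clash_tight(2) \<open>Y x x\<close> by blast
qed

lemma clash_pos_conf:
  assumes "u \<in> V" "clash u > 0"
  shows "\<exists>v. conf u v"
proof (rule ccontr)
  assume "\<not> ?thesis"
  then have "(\<Sum>y\<in>V. of_bool (conf u y) :: nat) = 0" by (intro sum.neutral) simp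
  then show False using clash_tight(3)[OF assms] by simp
qed

lemma conf_unique:
  assumes "conf u v" "conf x y"
  shows "x = u \<and> y = v \<or> x = v \<and> y = u"
proof -
  have V: "u \<in> V" "v \<in> V" "x \<in> V" "y \<in> V" using assms R_V R_V' by auto
  note t = clash_tight[OF V(1) clash_conf[OF assms(1)]]
  have 1: "z = v" if "conf u z" for z
    using sum_of_bool_eq_1D[OF finV t(3), of z v] that assms(1) V(2) R_V'[of u z] by simp
  have 2: "z = v" if "conf z z'" "z \<noteq> u" for z z'
  proof (rule ccontr)
    assume "z \<noteq> v"
    have z: "z \<in> V" using that R_V[of z z'] by simp
    have "(\<Sum>w\<in>{z, v}. clash w) \<le> (\<Sum>w\<in>V - {u}. clash w)"
      using finV z V that(2) R_irrefl[of u] assms(1) by (intro sum_mono2) auto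
    then have "clash z + clash v \<le> 1" using t(4) \<open>z \<noteq> v\<close> by simp
    then show False using clash_conf[OF that(1)] clash_conf[OF conf_sym[OF assms(1)]] by simp
  qed
  show ?thesis
  proof (cases "x = u")
    case True
    then show ?thesis using 1[of y] assms(2) by blast
  next
    case False
    then have "x = v" using 2 assms(2) by blast
    moreover have "y = u" using 2[of y x] conf_sym[OF assms(2)] \<open>x = v\<close> R_irrefl[of v] assms(2) by blast
    ultimately show ?thesis by blast
  qed
qed

context
  fixes u v
  assumes uv: "conf u v"
begin

lemma conf_ends: "u \<in> V" "v \<in> V" "u \<noteq> v"
  using uv R_V[of u v] R_V[of v u] R_sym[of u v] R_irrefl[of u] by auto

lemma link_eq:
  assumes "w \<in> V" "w \<noteq> u"
  shows "link u w = of_bool (w \<noteq> v)"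
proof -
  note t = clash_tight[OF conf_ends(1) clash_conf[OF uv]]
  have "clash w = of_bool (w = v)"
  proof (cases "w = v")
    case True
    then show ?thesis using clash_tight(1)[OF conf_ends(2) clash_conf[OF conf_sym[OF uv]]] by simp
  next
    case False
    then have "\<not> conf w z" for z using conf_unique[OF uv, of w z] assms by blast
    then have "\<not> clash w > 0" using clash_pos_conf[OF assms(1)] by blast
    then show ?thesis using False by simp
  qed
  moreover have c: "conf u w \<longleftrightarrow> w = v" using uv conf_unique[OF uv, of u w] assms by blast
  ultimately show ?thesis using t(6)[OF assms] unfolding c by (cases "w = v") simp_all
qed

lemma link_card:
  assumes "w \<in> V"
  shows "link u w = card {x. R u x \<and> B x w} + card {x. B u x \<and> R x w} + of_bool (Y u w) + of_bool (Y w u)"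
  unfolding link_def using nbrs(1,2)[of u] by (subst (1 2) sum_of_bool_V) auto

lemma not_path_v: "\<not> (R u x \<and> B x v)" "\<not> (B u x \<and> R x v)" "\<not> Y u v" "\<not> Y v u"
proof -
  have fin: "finite {x. R u x \<and> B x v}" "finite {x. B u x \<and> R x v}"
    using fin_nbrs(1,2)[of u] by auto
  have "link u v = 0" using link_eq conf_ends by auto
  then show "\<not> (R u x \<and> B x v)" "\<not> (B u x \<and> R x v)" "\<not> Y u v" "\<not> Y v u"
    using link_card[OF conf_ends(2)] fin by auto
qed

lemma path_one:
  assumes "w \<in> V" "w \<noteq> u" "w \<noteq> v"
  shows "card {x. R u x \<and> B x w} + card {x. B u x \<and> R x w} + of_bool (Y u w) + of_bool (Y w u) = 1"
  using link_eq[OF assms(1,2)] link_card[OF assms(1)] assms(3) by simp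

text \<open>The swap removes the conflict \<open>uv\<close> and creates exactly one, since \<open>w\<close> is linked to \<open>u\<close> once.
  So the overlap stays minimal.\<close>
lemma swap_optimal:
  assumes w: "w \<in> V" "w \<noteq> u" "w \<noteq> v"
  shows "optimal_overlay V R (swap_blue u w B) (\<lambda>x y. Y x (transpose u w y)) d1 d2 d3"
proof -
  let ?t = "transpose u w"
  have perm: "?t permutes V" by (rule permutes_swap_id[OF conf_ends(1) w(1)])
  have V_iff: "?t x \<in> V \<longleftrightarrow> x \<in> V" for x by (rule permutes_in_image[OF perm])
  have cards: "card {y. P (?t y)} = card {y. P y}" for P
  proof -
    have "{y. P (?t y)} = ?t ` {y. P y}" by (auto intro!: image_eqI[where x = "?t _"])
    then show ?thesis by (simp add: card_image)
  qed
  have "link u w = 1" "clash w = 0" "clash u = 1" "\<not> conf u w"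
    using link_eq w clash_tight(1)[OF conf_ends(1) clash_conf[OF uv]] clash_pos_conf[OF w(1)] conf_unique[OF uv]
    by auto
  then have eq: "overlap V R (swap_blue u w B) (\<lambda>x y. Y x (?t y)) = overlap V R B Y"
    using overlap_swap[OF conf_ends(1) w(1)] w by simp
  show ?thesis
  proof
    show "card {y. swap_blue u w B x y} \<le> d2" for x
      unfolding swap_blue_def cards[of "B (?t x)"] by (rule B_deg)
    show "card {y. Y x (?t y)} \<le> d3" for x
      unfolding cards[of "Y x"] by (rule Y_deg)
    show "2 * (d1 * d2 + d3) \<le> card V" by (rule small)
    show "x \<in> V" if "swap_blue u w B x y" for x y
      using that B_V V_iff unfolding swap_blue_def by blast
    show "x \<in> V \<and> y \<in> V" if "Y x (?t y)" for x y
      using that Y_V V_iff by blast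
    fix p assume p: "p permutes V"
    have "overlap V R B Y \<le> overlap V R (\<lambda>x y. B ((?t \<circ> p) x) ((?t \<circ> p) y)) (\<lambda>x y. Y x ((?t \<circ> p) y))"
      by (rule optimal) (rule permutes_compose[OF p perm])
    then show "overlap V R (swap_blue u w B) (\<lambda>x y. Y x (?t y))
      \<le> overlap V R (\<lambda>x y. swap_blue u w B (p x) (p y)) (\<lambda>x y. Y x (?t (p y)))"
      unfolding eq by (simp add: swap_blue_def)
  qed (auto simp: swap_blue_def finV R_irrefl R_deg Y_deg' B_irrefl intro: R_V dest: R_sym B_sym)
qed

text \<open>Swapping \<open>u\<close> along a link given by \<open>Y\<close> would create a loop in an optimal overlay. The degree
  statements hold because the number of links from \<open>u\<close> reaches its upper bound.\<close>
lemma Y_empty: "d3 = 0" "\<not> Y x y" and card_V_eq: "card V = 2 * d1 * d2"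
  and R_full: "card {x. R u x} = d1" and B_full: "card {x. B u x} = d2"
  and RB_full: "R u x \<Longrightarrow> card {y. B x y} = d2" and BR_full: "B u x \<Longrightarrow> card {y. R x y} = d1"
proof -
  have no: "\<not> Y u w" for w
  proof
    assume w: "Y u w"
    then have w': "w \<in> V" "w \<noteq> u" "w \<noteq> v" using Y_V no_loop not_path_v by auto
    interpret s: optimal_overlay V R "swap_blue u w B" "\<lambda>x y. Y x (transpose u w y)" d1 d2 d3
      by (rule swap_optimal[OF w'])
    show False using s.no_loop[of u] w by simp
  qed
  have tot: "card V = (\<Sum>x | R u x. card {y. B x y}) + (\<Sum>x | B u x. card {y. R x y})
     + card {y. Y u y} + card {y. Y y u}"
    using clash_tight(5)[OF conf_ends(1) clash_conf[OF uv]] sum_link[of u] by simp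
  have "card {y. Y u y} = 0" using no by simp
  then have d3: "d3 = 0" "card V = 2 * (d1 * d2)"
    and s: "(\<Sum>x | R u x. card {y. B x y}) = d1 * d2" "(\<Sum>x | B u x. card {y. R x y}) = d1 * d2"
    using tot small Y_deg'[of u] sum_link_parts[of u] by simp_all
  show "d3 = 0" by fact
  show "\<not> Y x y" using Y_deg[of x] fin_nbrs(3)[of x] d3 by auto
  show "card V = 2 * d1 * d2" using d3 by simp
  have pos: "d1 > 0" "d2 > 0"
    using conf_ends finV d3(2) by (auto intro!: Nat.gr0I)
  have "d1 * d2 \<le> card {x. R u x} * d2" "d1 * d2 \<le> card {x. B u x} * d1"
    using s sum_RB_le[of u] by auto
  then show full: "card {x. R u x} = d1" "card {x. B u x} = d2"
    using pos R_deg[of u] B_deg[of u] by (auto simp: mult.commute[of _ d1])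
  show "card {y. B x y} = d2" if x: "R u x"
  proof (rule ccontr)
    assume "card {y. B x y} \<noteq> d2"
    then have "(\<Sum>x | R u x. card {y. B x y}) < (\<Sum>x | R u x. d2)"
      using x fin_nbrs(1)[of u] B_deg by (intro sum_strict_mono_ex1) (auto simp: order.strict_iff_order)
    then show False using s full by simp
  qed
  show "card {y. R x y} = d1" if x: "B u x"
  proof (rule ccontr)
    assume "card {y. R x y} \<noteq> d1"
    then have "(\<Sum>x | B u x. card {y. R x y}) < (\<Sum>x | B u x. d1)"
      using x fin_nbrs(2)[of u] R_deg by (intro sum_strict_mono_ex1) (auto simp: order.strict_iff_order)
    then show False using s full by simp
  qed
qed

lemma path_exists:
  assumes "w \<in> V" "w \<noteq> u" "w \<noteq> v"
  shows "(\<exists>x. R u x \<and> B x w) \<or> (\<exists>x. B u x \<and> R x w)"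
proof (rule ccontr)
  assume "\<not> ?thesis"
  then have "{x. R u x \<and> B x w} = {}" "{x. B u x \<and> R x w} = {}" by auto
  then show False using path_one[OF assms] Y_empty(2) by (simp only:) simp
qed

lemma path_unique:
  assumes "w \<noteq> u"
  shows "R u x \<Longrightarrow> B x w \<Longrightarrow> R u y \<Longrightarrow> B y w \<Longrightarrow> x = y"
    and "B u x \<Longrightarrow> R x w \<Longrightarrow> B u y \<Longrightarrow> R y w \<Longrightarrow> x = y"
    and "R u x \<Longrightarrow> B x w \<Longrightarrow> B u y \<Longrightarrow> \<not> R y w"
proof -
  have fin: "finite {x. R u x \<and> B x w}" "finite {x. B u x \<and> R x w}"
    using fin_nbrs(1,2)[of u] by auto
  have le: "card {x. R u x \<and> B x w} + card {x. B u x \<and> R x w} = 1"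
    if "R u z \<and> B z w \<or> B u z \<and> R z w" for z
  proof -
    have "w \<in> V" using that R_V R_sym B_V B_sym by blast
    moreover have "w \<noteq> v" using that not_path_v by blast
    ultimately show ?thesis using path_one[OF _ assms] Y_empty(2) by simp
  qed
  show "x = y" if "R u x" "B x w" "R u y" "B y w"
  proof -
    have "card {x. R u x \<and> B x w} \<le> 1" using le[of x] that by simp
    then show ?thesis using that fin by (auto simp: card_le_Suc0_iff_eq)
  qed
  show "x = y" if "B u x" "R x w" "B u y" "R y w"
  proof -
    have "card {x. B u x \<and> R x w} \<le> 1" using le[of x] that by simp
    then show ?thesis using that fin by (auto simp: card_le_Suc0_iff_eq)
  qed
  show "\<not> R y w" if "R u x" "B x w" "B u y"
  proof
    assume "R y w"
    then have "card {x. R u x \<and> B x w} > 0" "card {x. B u x \<and> R x w} > 0"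
      using that fin by (auto simp: card_gt_0_iff)
    then show False using le[of x] that by simp
  qed
qed

lemma V_cases:
  assumes "w \<in> V"
  obtains "w = u" | "w = v" | x where "R u x" "B x w" "w \<noteq> u" "w \<noteq> v" 
    | x where "B u x" "R x w" "w \<noteq> u" "w \<noteq> v"
  using path_exists[OF assms] by blast

lemma no_path_v: "R u x \<Longrightarrow> \<not> B x v" "B u x \<Longrightarrow> \<not> R x v" "R u x \<Longrightarrow> \<not> B v x" "B u x \<Longrightarrow> \<not> R v x"
  using not_path_v B_sym R_sym by metis+

lemma path_back: "R u x \<Longrightarrow> B u x \<Longrightarrow> x = v"
  using conf_unique[OF uv, of u x] by blast

lemma conf_colours: "R u v" "B u v" "conf v u" "R v u" "B v u"
  using uv conf_sym by blast+

text \<open>The swap along a red-blue path from \<open>u\<close> over \<open>a\<close> to \<open>w\<close> moves the conflict to \<open>ua\<close>. For \<open>a = v\<close>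
  the conflict stays at \<open>uv\<close>, but \<open>u\<close> gets new blue neighbours.\<close>
lemma swap_path:
  assumes "R u a" "B a w" "w \<noteq> u"
  shows "optimal_overlay V R (swap_blue u w B) (\<lambda>x y. Y x (transpose u w y)) d1 d2 d3"
    and "R u a \<and> swap_blue u w B u a"
proof -
  have "w \<noteq> v" "w \<noteq> a" "a \<noteq> u" using assms no_path_v B_irrefl R_irrefl by blast+
  then show "optimal_overlay V R (swap_blue u w B) (\<lambda>x y. Y x (transpose u w y)) d1 d2 d3"
    using assms by (intro swap_optimal B_V'[of a w])
  show "R u a \<and> swap_blue u w B u a"
    using assms B_sym \<open>w \<noteq> a\<close> \<open>a \<noteq> u\<close> by (simp add: swap_blue_def)
qed

end

text \<open>Permuting the blue graph by \<open>p\<close> has the same effect on the overlap as permuting the red one by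
  the inverse of \<open>p\<close>, so the colours play symmetric roles.\<close>
lemma colour_dual: "optimal_overlay V B R (\<lambda>x y. Y y x) d2 d1 d3"
proof
  fix p assume p: "p permutes V"
  let ?q = "inv p"
  have q: "?q permutes V" by (rule permutes_inv[OF p])
  have qV: "bij_betw p V V" by (rule permutes_imp_bij[OF p])
  have pq: "?q (p x) = x" for x by (rule permutes_inverses(2)[OF p])
  have swp: "overlap V B R (\<lambda>x y. Y y x) = overlap V R B Y"
    unfolding overlap_def by (simp only: conj_commute)
  have "overlap V R (\<lambda>x y. B (?q x) (?q y)) (\<lambda>x y. Y x (?q y))
      = overlap V B (\<lambda>x y. R (p x) (p y)) (\<lambda>x y. Y (p y) x)"
    unfolding overlap_def
    by (subst (1 2 3) sum.reindex_bij_betw[OF qV, symmetric]) (simp only: pq conj_commute)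
  then show "overlap V B R (\<lambda>x y. Y y x) \<le> overlap V B (\<lambda>x y. R (p x) (p y)) (\<lambda>x y. Y (p y) x)"
    using optimal[OF q] unfolding swp by simp
next
  show "2 * (d2 * d1 + d3) \<le> card V" using small by (simp only: mult.commute)
qed (auto simp: finV R_irrefl R_deg Y_deg Y_deg' B_deg B_irrefl intro: R_V B_V dest: R_sym B_sym Y_V)

section \<open>No conflict when both degrees exceed one\<close>

text \<open>Suppose \<open>a\<close> and \<open>a'\<close> are joined in blue. As \<open>a\<close> has a second blue neighbour \<open>w\<close>, swapping \<open>u\<close>
  with \<open>w\<close> moves the conflict to \<open>ua\<close> and keeps the red-blue path from \<open>u\<close> over \<open>a'\<close> to \<open>a\<close>. But the
  other end of a conflict is never linked to \<open>u\<close>.\<close>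
lemma nbr_independent:
  assumes uv: "conf u v" and d2: "d2 \<ge> 2" and a: "R u a" "R u a'"
  shows "\<not> B a a'"
proof
  assume aa: "B a a'"
  have "card {y. B a y} = d2" by (rule RB_full[OF uv a(1)])
  then have "\<not> {y. B a y} \<subseteq> {a'}" using d2 card_mono[of "{a'}" "{y. B a y}"] by auto
  then obtain w where w: "B a w" "w \<noteq> a'" by blast
  have av: "a \<noteq> v" using no_path_v(3)[OF uv a(2)] aa by blast
  have wu: "w \<noteq> u" using path_back[OF uv a(1)] av w(1) B_sym by blast
  have au: "a \<noteq> u" "a' \<noteq> u" using a R_irrefl by blast+
  have aw: "a \<noteq> w" using w(1) B_irrefl by blast
  interpret s: optimal_overlay V R "swap_blue u w B" "\<lambda>x y. Y x (transpose u w y)" d1 d2 d3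
    by (rule swap_path(1)[OF uv a(1) w(1) wu])
  note ua = swap_path(2)[OF uv a(1) w(1) wu]
  have "swap_blue u w B a' a" using aa w(2) au aw B_sym by (simp add: swap_blue_def)
  then show False using s.no_path_v(1)[OF ua a(2)] by blast
qed

text \<open>After the swap of \<open>u\<close> with \<open>w\<close>, the vertex \<open>p\<close> is a blue neighbour of \<open>u\<close>, so \<open>q\<close> ends a blue-red
  path from \<open>u\<close>. The set of ends of red-blue paths from \<open>u\<close> is the same as before the swap, and no vertex
  other than \<open>u\<close> ends paths of both kinds.\<close>
lemma red_nbr_not_reached:
  assumes uv: "conf u v" and d2: "d2 \<ge> 2"
    and w: "R u a" "B a w" "w \<noteq> u" and q: "B w p" "p \<noteq> u" "R p q" "q \<noteq> u"
    and x: "R u x"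
  shows "\<not> B x q"
proof
  assume xq: "B x q"
  interpret s: optimal_overlay V R "swap_blue u w B" "\<lambda>x y. Y x (transpose u w y)" d1 d2 d3
    by (rule swap_path(1)[OF uv w])
  note ua = swap_path(2)[OF uv w]
  have wp: "w \<noteq> p" using q(1) B_irrefl by blast
  have up: "swap_blue u w B u p" using q(1,2) wp by (simp add: swap_blue_def)
  have xu: "x \<noteq> u" using x R_irrefl by blast
  have xw: "x \<noteq> w" using nbr_independent[OF uv d2 w(1)] x w(2) by blast
  show False
  proof (cases "q = w")
    case False
    then have "swap_blue u w B x q" using xq q(4) xu xw by (simp add: swap_blue_def)
    then show False using s.path_unique(3)[OF ua q(4) x _ up] q(3) by blast
  next
    case True
    \<comment> \<open>the blue edge \<open>vu\<close> has become \<open>vw\<close>, so \<open>q = w\<close> is still reached, now over \<open>v\<close>\<close>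
    have "v \<noteq> w" using no_path_v(1)[OF uv w(1)] w(2) by blast
    then have "swap_blue u w B v q" using True conf_colours(5)[OF uv] conf_ends[OF uv] by (simp add: swap_blue_def)
    then show False using s.path_unique(3)[OF ua q(4) conf_colours(1)[OF uv] _ up] q(3) by blast
  qed
qed

end

locale dense_optimal_overlay = optimal_overlay +
  assumes d1: "d1 \<ge> 2" and d2: "d2 \<ge> 2"
begin

lemma dual_dense: "dense_optimal_overlay V B R (\<lambda>x y. Y y x) d2 d1 d3"
  using colour_dual d1 d2 by (simp add: dense_optimal_overlay_def dense_optimal_overlay_axioms_def)

lemma swap_dense:
  assumes "conf u v" "R u a" "B a w" "w \<noteq> u"
  shows "dense_optimal_overlay V R (swap_blue u w B) (\<lambda>x y. Y x (transpose u w y)) d1 d2 d3"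
  using swap_path(1)[OF assms] d1 d2
  by (simp add: dense_optimal_overlay_def dense_optimal_overlay_axioms_def)

text \<open>Not being the end of a red-blue path, \<open>a\<close> has a red neighbour \<open>b\<close> that is a blue neighbour
  of \<open>u\<close>. If \<open>b \<noteq> v\<close>, the same argument with the colours exchanged makes \<open>b\<close> the end of a red-blue path
  from \<open>u\<close>; but the red neighbours of \<open>a\<close> other than \<open>u\<close> are not, by \<open>red_nbr_not_reached\<close> with \<open>p = a\<close>.\<close>
lemma red_nbrs_shared:
  assumes uv: "conf u v" and a: "R u a" "a \<noteq> v"
  shows "R v a"
proof -
  interpret D: dense_optimal_overlay V B R "\<lambda>x y. Y y x" d2 d1 d3 by (rule dual_dense)
  have uv_d: "B u v \<and> R u v" using uv by blast
  have "card {y. B a y} > 0" using RB_full[OF uv a(1)] d2 by simp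
  then obtain w where w: "B a w" by (auto simp: card_gt_0_iff)
  have au: "a \<noteq> u" using a R_irrefl by blast
  have wu: "w \<noteq> u" using path_back[OF uv a(1)] a(2) w B_sym by blast
  have aS: "\<not> B x a" if "R u x" for x using nbr_independent[OF uv d2 that a(1)] .
  have out: "\<not> B x q" if "R a q" "q \<noteq> u" "R u x" for x q
    using red_nbr_not_reached[OF uv d2 a(1) w wu B_sym[OF w] au that] .
  obtain b where b: "B u b" "R b a"
    using V_cases[OF uv R_V'[OF a(1)]] au a(2) aS by metis
  have "b = v"
  proof (rule ccontr)
    assume bv: "b \<noteq> v"
    have bu: "b \<noteq> u" using b B_irrefl by blast
    have "\<not> R c b" if "B u c" for c using D.nbr_independent[OF uv_d d1 that b(1)] .
    then obtain x where "R u x" "B x b" using V_cases[OF uv B_V'[OF b(1)]] bu bv by metis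
    then show False using out[OF R_sym[OF b(2)] bu] by blast
  qed
  then show ?thesis using b by blast
qed

lemma blue_nbrs_shared:
  assumes "conf u v" "B u b" "b \<noteq> v"
  shows "B v b"
proof -
  interpret D: dense_optimal_overlay V B R "\<lambda>x y. Y y x" d2 d1 d3 by (rule dual_dense)
  show ?thesis using D.red_nbrs_shared assms by blast
qed

text \<open>This is \<open>blue_nbrs_shared\<close> for the conflict \<open>ua\<close> that the swap of \<open>u\<close> with \<open>w\<close> produces, read
  back in the original overlay, where \<open>w\<close> has the blue neighbours that \<open>u\<close> gets by the swap.\<close>
lemma far_blue_nbrs_shared:
  assumes uv: "conf u v" and a: "R u a" "a \<noteq> v" and w: "B a w" and p: "p \<noteq> a" "p \<noteq> w"
  shows "B a p \<longleftrightarrow> B w p"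
proof -
  have au: "a \<noteq> u" "a \<noteq> w" using a w R_irrefl B_irrefl by blast+
  have nu: "\<not> B a u" using path_back[OF uv a(1)] a(2) B_sym by blast
  then have wu: "w \<noteq> u" using w by blast
  have nwu: "\<not> B w u"
  proof
    assume "B w u"
    then have "B u w" by (rule B_sym)
    moreover have "w \<noteq> v" using no_path_v(1)[OF uv a(1)] w by blast
    ultimately have "B v w" by (rule blue_nbrs_shared[OF uv])
    then show False using path_unique(1)[OF uv wu a(1) w conf_colours(1)[OF uv]] a(2) by blast
  qed
  interpret s: dense_optimal_overlay V R "swap_blue u w B" "\<lambda>x y. Y x (transpose u w y)" d1 d2 d3
    by (rule swap_dense[OF uv a(1) w wu])
  note ua = swap_path(2)[OF uv a(1) w wu]
  show ?thesis
  proof (cases "p = u")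
    case True
    then show ?thesis using nu nwu by blast
  next
    case False
    then have 1: "swap_blue u w B a p \<longleftrightarrow> B a p" "swap_blue u w B u p \<longleftrightarrow> B w p"
      using p au by (simp_all add: swap_blue_def)
    show ?thesis
      using s.blue_nbrs_shared[OF ua, of p] s.blue_nbrs_shared[OF s.conf_sym[OF ua], of p] False p(1)
      unfolding 1 by blast
  qed
qed

text \<open>Take a path from \<open>u\<close> over a red neighbour \<open>a \<noteq> v\<close> to two blue neighbours \<open>w\<close> and \<open>p\<close> of \<open>a\<close>.
  By \<open>far_blue_nbrs_shared\<close>, \<open>w\<close> and \<open>p\<close> are joined in blue. The vertex \<open>p\<close> has a red neighbour \<open>q\<close>, which
  ends no red-blue path from \<open>u\<close> and hence ends a blue-red path over some \<open>b\<close>. If \<open>b = v\<close>, then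
  \<open>q\<close> is also a red neighbour of \<open>u\<close>, so its red neighbour \<open>p\<close> ends no red-blue path from \<open>u\<close>, against
  the choice of \<open>p\<close>. If \<open>b \<noteq> v\<close>, then \<open>p\<close> is also a red neighbour of \<open>b\<close>, which links it to \<open>u\<close> a second
  time.\<close>
lemma no_conf: "\<not> conf u v"
proof
  assume uv: "conf u v"
  interpret D: dense_optimal_overlay V B R "\<lambda>x y. Y y x" d2 d1 d3 by (rule dual_dense)
  have uv_d: "B u v \<and> R u v" using uv by blast
  have pick: "\<exists>y. P y \<and> y \<noteq> z" if "card {y. P y} \<ge> 2" for P :: "'a \<Rightarrow> bool" and z
  proof (rule ccontr)
    assume "\<not> ?thesis"
    then have "{y. P y} \<subseteq> {z}" by blast
    then show False using that card_mono[of "{z}" "{y. P y}"] by simp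
  qed
  obtain a where a: "R u a" "a \<noteq> v" using pick[of "R u" v] R_full[OF uv] d1 by auto
  note full = RB_full[OF uv a(1)]
  obtain w where w: "B a w" using pick[of "B a" a] full d2 by auto
  obtain p where p: "B a p" "p \<noteq> w" using pick[of "B a" w] full d2 by auto
  have au: "a \<noteq> u" "p \<noteq> a" using a p R_irrefl B_irrefl by blast+
  have nu: "\<not> B a u" using path_back[OF uv a(1)] a(2) B_sym by blast
  then have wu: "w \<noteq> u" "p \<noteq> u" using w p by blast+
  have wp: "B w p" using far_blue_nbrs_shared[OF uv a w au(2) p(2)] p(1) by blast
  interpret s: dense_optimal_overlay V R "swap_blue u w B" "\<lambda>x y. Y x (transpose u w y)" d1 d2 d3
    by (rule swap_dense[OF uv a(1) w wu(1)])
  note ua = swap_path(2)[OF uv a(1) w wu(1)]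
  have "swap_blue u w B u p" using wp wu(2) p(2) by (simp add: swap_blue_def)
  then have "card {y. R p y} = d1" by (rule s.BR_full[OF ua])
  then obtain q where q: "R p q" using pick[of "R p" p] d1 by auto
  have nRup: "\<not> R u p" using nbr_independent[OF uv d2 a(1), of p] p(1) by blast
  have qu: "q \<noteq> u" using nRup q R_sym by blast
  have pv: "p \<noteq> v" using no_path_v(1)[OF uv a(1)] p(1) by blast
  have nRvp: "\<not> R v p" using red_nbrs_shared[OF conf_colours(3)[OF uv], of p] nRup wu(2) by blast
  then have qv: "q \<noteq> v" using q R_sym by blast
  have "\<not> B x q" if "R u x" for x
    using red_nbr_not_reached[OF uv d2 a(1) w wu(1) wp wu(2) q qu that] .
  then obtain b where b: "B u b" "R b q" using V_cases[OF uv R_V'[OF q]] qu qv by metis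
  show False
  proof (cases "b = v")
    case True
    then have uq: "R u q" using red_nbrs_shared[OF conf_colours(3)[OF uv]] b qu by blast
    obtain z where z: "B q z" using pick[of "B q" q] RB_full[OF uv uq] d2 by auto
    have zu: "z \<noteq> u" using path_back[OF uv uq] z qv B_sym by blast
    show False
      using red_nbr_not_reached[OF uv d2 uq z zu B_sym[OF z] qu R_sym[OF q] wu(2) a(1)] p(1) by blast
  next
    case False
    have "p \<noteq> b"
    proof
      assume "p = b"
      then have "B v p" using blue_nbrs_shared[OF uv] b pv by blast
      then show False using path_unique(1)[OF uv wu(2) a(1) p(1) conf_colours(1)[OF uv]] a(2) by blast
    qed
    then have "R b p"
      using D.far_blue_nbrs_shared[OF uv_d b(1) False b(2), of p] R_sym[OF q] q R_irrefl by blast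
    then show False using path_unique(3)[OF uv wu(2) a(1) p(1) b(1)] by blast
  qed
qed

end

section \<open>Conflicts with a matching\<close>
definition extremal_relations ::
  "'a set \<Rightarrow> nat \<Rightarrow> ('a \<Rightarrow> 'a \<Rightarrow> bool) \<Rightarrow> ('a \<Rightarrow> 'a \<Rightarrow> bool) \<Rightarrow> bool" where
  "extremal_relations V m R B \<longleftrightarrow>
     (\<forall>x\<in>V. card {y. R x y} = 1) \<and>
     ((\<exists>X Z. V = X \<union> Z \<and> X \<inter> Z = {} \<and> card X = m \<and> card Z = m \<and>
         (\<forall>x y. B x y \<longleftrightarrow> x \<in> X \<and> y \<in> Z \<or> x \<in> Z \<and> y \<in> X)) \<and> odd m \<or>
      (\<exists>K\<subseteq>V. card K = m + 1 \<and> (\<forall>x\<in>K. \<forall>y\<in>K. x \<noteq> y \<longrightarrow> B x y)))"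

lemma even_card_matched:
  fixes R :: "'a \<Rightarrow> 'a \<Rightarrow> bool"
  assumes "finite C" and sym: "\<And>x y. R x y \<Longrightarrow> R y x" and irr: "\<And>x. \<not> R x x"
    and ex: "\<And>x. x \<in> C \<Longrightarrow> \<exists>y\<in>C. R x y"
    and uniq: "\<And>x y z. x \<in> C \<Longrightarrow> R x y \<Longrightarrow> R x z \<Longrightarrow> y = z"
  shows "even (card C)"
proof -
  let ?P = "{{x, y} | x y. x \<in> C \<and> y \<in> C \<and> R x y}"
  have U: "\<Union>?P = C"
  proof (rule equalityI)
    show "\<Union>?P \<subseteq> C" by blast
    show "C \<subseteq> \<Union>?P"
    proof
      fix x assume x: "x \<in> C"
      then obtain y where "y \<in> C" "R x y" using ex by blast
      then have "{x, y} \<in> ?P" using x by blast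
      then show "x \<in> \<Union>?P" by blast
    qed
  qed
  have "2 dvd card (\<Union>?P)"
  proof (rule dvd_partition)
    show "finite (\<Union>?P)" unfolding U by fact
    show "\<forall>c\<in>?P. 2 dvd card c"
    proof
      fix c assume "c \<in> ?P"
      then obtain x y where "c = {x, y}" "R x y" by blast
      moreover have "x \<noteq> y" using \<open>R x y\<close> irr by blast
      ultimately show "2 dvd card c" by simp
    qed
    show "\<forall>c1\<in>?P. \<forall>c2\<in>?P. c1 \<noteq> c2 \<longrightarrow> c1 \<inter> c2 = {}"
    proof (intro ballI impI)
      fix c1 c2 assume c: "c1 \<in> ?P" "c2 \<in> ?P" "c1 \<noteq> c2"
      have norm: "\<exists>z. c = {x, z} \<and> R x z" if cP: "c \<in> ?P" and x: "x \<in> c" for c x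
      proof -
        obtain a b where ab: "c = {a, b}" "R a b" using cP by blast
        show ?thesis
        proof (cases "x = a")
          case True
          then show ?thesis using ab by blast
        next
          case False
          then have "x = b" using x ab by blast
          then have "c = {x, a} \<and> R x a" using ab sym[OF ab(2)] by blast
          then show ?thesis by blast
        qed
      qed
      show "c1 \<inter> c2 = {}"
      proof (rule ccontr)
        assume "c1 \<inter> c2 \<noteq> {}"
        then obtain x where x: "x \<in> c1" "x \<in> c2" by blast
        have "x \<in> C" using c(1) x(1) by blast
        obtain z1 z2 where "c1 = {x, z1}" "R x z1" "c2 = {x, z2}" "R x z2"
          using norm[OF c(1) x(1)] norm[OF c(2) x(2)] by blast
        moreover have "z1 = z2" using uniq[OF \<open>x \<in> C\<close>] calculation by blast
        ultimately show False using c(3) by simp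
      qed
    qed
  qed
  then show ?thesis unfolding U .
qed

context optimal_overlay
begin

text \<open>For \<open>y \<noteq> v\<close> the red neighbour \<open>z\<close> of \<open>y\<close> is linked to \<open>u\<close> either over \<open>v\<close> or over \<open>y\<close>,
  and not both, as red is a matching. So whether \<open>u\<close> and \<open>y\<close> are joined in blue is determined by the
  blue neighbourhood of \<open>v\<close>. The swap of \<open>u\<close> with \<open>w\<close> does not change that neighbourhood, because it
  contains both \<open>u\<close> and \<open>w\<close>; hence it does not change the blue neighbours of \<open>u\<close> either.\<close>
lemma matching_blue_twins:
  assumes uv: "conf u v" and d1: "d1 = 1" and w: "B v w" "w \<noteq> u" and y: "y \<noteq> u" "y \<noteq> w"
  shows "B u y \<longleftrightarrow> B w y"
proof (cases "y \<in> V")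
  case False
  then show ?thesis using B_V' by blast
next
  case yV: True
  have R1: "z = z'" if "R x z" "R x z'" for x z z'
    using R_deg[of x] that fin_nbrs(1)[of x] d1 by (auto simp: card_le_Suc0_iff_eq)
  note V = conf_ends[OF uv] and uv' = conf_colours[OF uv]
  interpret s: optimal_overlay V R "swap_blue u w B" "\<lambda>x y. Y x (transpose u w y)" d1 d2 d3
    by (rule swap_path(1)[OF uv uv'(1) w])
  note sv = swap_path(2)[OF uv uv'(1) w]
  have wv: "w \<noteq> v" using w B_irrefl by blast
  have Bv: "swap_blue u w B v x \<longleftrightarrow> B v x" if "x \<noteq> u" for x
    using that w wv uv' V by (cases "x = w") (simp_all add: swap_blue_def)
  show ?thesis
  proof (cases "y = v")
    case True
    then show ?thesis using uv' w B_sym by blast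
  next
    case yv: False
    have path: "(\<exists>x. R u x \<and> B' x z) \<longleftrightarrow> B' v z" for B' :: "'a \<Rightarrow> 'a \<Rightarrow> bool" and z
      using R1 uv' by blast
    have yu_path: "\<exists>z. R y z \<and> z \<noteq> u \<and> z \<noteq> v"
    proof -
      have "\<exists>z. R y z"
      proof (rule V_cases[OF uv yV])
        fix x assume "R u x" "B x y"
        then have "B v y" using R1 uv' by blast
        then have "card {z. R y z} = d1" using BR_full[OF uv'(3)] by blast
        then show ?thesis using d1 by (auto simp: card_1_singleton_iff)
      qed (use y yv R_sym in blast)+
      then obtain z where z: "R y z" by blast
      have "z \<noteq> u" "z \<noteq> v" using R1[of u y v] R1[of v y u] R_sym[OF z] uv' y yv by blast+
      then show ?thesis using z by blast
    qed
    then obtain z where z: "R y z" "z \<noteq> u" "z \<noteq> v" by blast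
    have zV: "z \<in> V" using z R_V' by blast
    have viaT: "(\<exists>x. B' u x \<and> R x z) \<longleftrightarrow> B' u y" for B' :: "'a \<Rightarrow> 'a \<Rightarrow> bool"
    proof -
      have "x = y" if "R x z" for x using R1[of z x y] R_sym[OF that] R_sym[OF z(1)] by blast
      then show ?thesis using z by blast
    qed
    have "B u y \<longleftrightarrow> \<not> B v z"
      using path_exists[OF uv zV z(2,3)] path_unique(3)[OF uv z(2), of v y] uv'(1) z(1)
      unfolding path viaT by blast
    moreover have "swap_blue u w B u y \<longleftrightarrow> \<not> swap_blue u w B v z"
      using s.path_exists[OF sv zV z(2,3)] s.path_unique(3)[OF sv z(2), of v y] uv'(1) z(1)
      unfolding path viaT by blast
    moreover have "swap_blue u w B u y \<longleftrightarrow> B w y" using y by (simp add: swap_blue_def)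
    ultimately show ?thesis using Bv[OF z(2)] by blast
  qed
qed

text \<open>If every blue neighbour of \<open>v\<close> is \<open>u\<close> or a blue neighbour of \<open>u\<close>, all of these are adjacent
  twins and form a clique with \<open>u\<close> and \<open>v\<close>. Otherwise one of them is not adjacent to its twin \<open>u\<close>, hence
  none is, and the neighbourhoods of \<open>u\<close> and \<open>v\<close> are the sides of a complete bipartite graph. In that
  case the red edge \<open>uv\<close> joins the two sides and, being the only double edge, leaves the rest of each
  side matched within itself, so each side has odd size.\<close>
lemma matching_extremal:
  assumes uv: "conf u v" and d1: "d1 = 1"
  shows "extremal_relations V d2 R B"
proof -
  have R1: "z = z'" if "R x z" "R x z'" for x z z'
    using R_deg[of x] that fin_nbrs(1)[of x] d1 by (auto simp: card_le_Suc0_iff_eq)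
  note V = conf_ends[OF uv] and uv' = conf_colours[OF uv]
  note twins = matching_blue_twins[OF uv d1]
  have cardV: "card V = 2 * d2" using card_V_eq[OF uv] d1 by simp
  have ex: "\<exists>y. R x y" if x: "x \<in> V" for x
  proof (rule V_cases[OF uv x])
    fix y assume "R u y" "B y x"
    then have "B v x" using R1 uv' by blast
    then have "card {z. R x z} = d1" using BR_full[OF uv'(3)] by blast
    then show ?thesis using d1 by (auto simp: card_1_singleton_iff)
  qed (use uv' R_sym in blast)+
  have pm: "card {y. R x y} = 1" if x: "x \<in> V" for x
  proof -
    obtain y where "R x y" using ex[OF x] by blast
    then have "{y. R x y} = {y}" using R1 by blast
    then show ?thesis by simp
  qed
  let ?Z = "{y. B u y}" and ?X = "{y. B v y}"
  have fin: "finite ?Z" "finite ?X" by (rule fin_nbrs)+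
  have cards: "card ?Z = d2" "card ?X = d2" using B_full[OF uv] B_full[OF uv'(3)] by simp_all
  show ?thesis
  proof (cases "\<forall>w. B v w \<and> w \<noteq> u \<longrightarrow> B u w")
    case True
    let ?K = "insert u ?Z"
    have "?X - {u} \<subseteq> ?Z - {v}" using True B_irrefl by blast
    moreover have "card (?Z - {v}) = card (?X - {u})" using cards uv' by simp
    ultimately have eq: "?X - {u} = ?Z - {v}" using fin by (intro card_subset_eq) auto
    have "B x y" if xy: "x \<in> ?K" "y \<in> ?K" "x \<noteq> y" for x y
    proof -
      have vB: "B v z" if "z \<in> ?K" "z \<noteq> v" for z using that eq uv' by blast
      consider "x = u" | "y = u" | "x = v" | "y = v" | "x \<noteq> u" "y \<noteq> u" "x \<noteq> v" "y \<noteq> v" by blast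
      then show ?thesis
      proof cases
        case 5
        then show ?thesis using twins[OF vB[of x], of y] xy by blast
      qed (use xy vB B_sym in blast)+
    qed
    moreover have "card ?K = d2 + 1" using fin cards B_irrefl by simp
    moreover have "?K \<subseteq> V" using V nbrs(2)[of u] by blast
    ultimately show ?thesis unfolding extremal_relations_def using pm by blast
  next
    case False
    then obtain w0 where w0: "B v w0" "w0 \<noteq> u" "\<not> B u w0" by blast
    have disj: "\<not> B u z" if z: "B v z" "z \<noteq> u" for z
    proof
      assume uz: "B u z"
      then have "z \<noteq> w0" using w0 by blast
      then have "B w0 z" using twins[OF w0(1,2), of z] z uz by blast
      moreover have "B u w0 \<longleftrightarrow> B z w0" using twins[OF z, of w0] w0 \<open>z \<noteq> w0\<close> by blast
      ultimately show False using w0 B_sym by blast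
    qed
    have XZ: "?X \<inter> ?Z = {}" using disj B_irrefl by blast
    have "card (?X \<union> ?Z) = card V" using card_Un_disjoint[OF fin(2,1) XZ] cards cardV by simp
    then have VXZ: "V = ?X \<union> ?Z" using nbrs(2) finV by (intro card_subset_eq[symmetric]) auto
    have BX: "B x y \<longleftrightarrow> y \<in> ?Z" if x: "x \<in> ?X" for x y
    proof (cases "x = u")
      case False
      then have xu: "\<not> B u x" "\<not> B x u" "B v x" using disj x B_sym by blast+
      then show ?thesis using twins[of x y] False B_irrefl by (cases "y = u"; cases "y = x") auto
    qed simp
    have ZZ: "\<not> B x y" if xy: "x \<in> ?Z" "y \<in> ?Z" for x y
    proof
      assume B: "B x y"
      have "insert y ?X \<subseteq> {z. B x z}" using BX xy B B_sym by blast
      then have "card (insert y ?X) \<le> d2"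
        using card_mono[OF fin_nbrs(2)[of x]] B_deg[of x] by (metis le_trans)
      then show False using xy XZ fin cards by (simp add: card_insert_if split: if_splits) blast
    qed
    have Biff: "B x y \<longleftrightarrow> x \<in> ?X \<and> y \<in> ?Z \<or> x \<in> ?Z \<and> y \<in> ?X" for x y
    proof
      assume B: "B x y"
      have "x \<in> ?X \<union> ?Z" "y \<in> ?X \<union> ?Z" using B_V[OF B] B_V'[OF B] VXZ by auto
      then show "x \<in> ?X \<and> y \<in> ?Z \<or> x \<in> ?Z \<and> y \<in> ?X"
        using BX[of x y] BX[of y x] ZZ[of x y] B B_sym[OF B] by blast
    next
      assume "x \<in> ?X \<and> y \<in> ?Z \<or> x \<in> ?Z \<and> y \<in> ?X"
      then show "B x y" using BX B_sym by blast
    qed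
    have "even (card (?X - {u}))"
    proof (rule even_card_matched[where R = R])
      fix x assume x: "x \<in> ?X - {u}"
      then have xV: "x \<in> V" and xv: "x \<noteq> v" using nbrs(2)[of v] B_irrefl by auto
      obtain y where y: "R x y" using ex[OF xV] by blast
      have yuv: "y \<noteq> u" "y \<noteq> v" using R1[of u x v] R1[of v x u] R_sym[OF y] uv' x xv by blast+
      have "\<not> B u y" using path_unique(3)[OF uv'(3) yuv(2), of u x] uv' x y by blast
      moreover have "y \<in> ?X \<union> ?Z" using R_V'[OF y] VXZ by blast
      ultimately show "\<exists>y\<in>?X - {u}. R x y" using y yuv by blast
    qed (use fin R_sym R_irrefl R1 in blast)+
    then have "odd d2" using cards uv' fin card_Suc_Diff1[of ?X u] by (metis even_Suc mem_Collect_eq)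
    then show ?thesis
      unfolding extremal_relations_def using pm VXZ XZ cards Biff by blast
  qed
qed

theorem conflict_extremal:
  assumes uv: "conf u v"
  shows "d3 = 0 \<and> card V = 2 * (d1 * d2) \<and>
    (extremal_relations V (card V div 2) R B \<or> extremal_relations V (card V div 2) B R)"
proof -
  interpret D: optimal_overlay V B R "\<lambda>x y. Y y x" d2 d1 d3 by (rule colour_dual)
  have cardV: "card V = 2 * d1 * d2" by (rule card_V_eq[OF uv])
  have "card V > 0" using conf_ends[OF uv] finV by (auto simp: card_gt_0_iff)
  then have pos: "d1 > 0" "d2 > 0" using cardV by auto
  have "d1 = 1 \<or> d2 = 1"
  proof (rule ccontr)
    assume "\<not> ?thesis"
    then interpret dense_optimal_overlay V R B Y d1 d2 d3
      using pos by unfold_locales auto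
    show False using no_conf uv by blast
  qed
  then have "extremal_relations V (card V div 2) R B \<or> extremal_relations V (card V div 2) B R"
    using matching_extremal[OF uv] D.matching_extremal[of u v] uv cardV by auto
  then show ?thesis using Y_empty(1)[OF uv] cardV by simp
qed

end

lemma edge_verts:
  assumes "finite_simple_graph G" "{x, y} \<in> edges G"
  shows "x \<in> verts G" "y \<in> verts G" "x \<noteq> y"
proof -
  have "{x, y} \<subseteq> verts G" "card {x, y} = 2" using assms by (auto simp: finite_simple_graph_def)
  then show "x \<in> verts G" "y \<in> verts G" "x \<noteq> y" by auto
qed

lemma degree_eq_card_nbrs:
  assumes G: "finite_simple_graph G"
  shows "degree G v = card {y. {v, y} \<in> edges G}"
proof -
  have "{e \<in> edges G. v \<in> e} = (\<lambda>y. {v, y}) ` {y. {v, y} \<in> edges G}"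
  proof (rule equalityI; rule subsetI)
    fix e assume e: "e \<in> {e \<in> edges G. v \<in> e}"
    then have "card e = 2" using G by (auto simp: finite_simple_graph_def)
    then obtain a b where "e = {a, b}" by (auto simp: card_2_iff)
    then have "\<exists>y. e = {v, y}" using e by auto
    then show "e \<in> (\<lambda>y. {v, y}) ` {y. {v, y} \<in> edges G}" using e by blast
  qed auto
  moreover have "inj (\<lambda>y. {v, y})" by (auto simp: inj_on_def doubleton_eq_iff)
  ultimately show ?thesis unfolding degree_def by (simp add: card_image inj_on_subset)
qed

lemma finite_nbrs:
  assumes "finite_simple_graph G"
  shows "finite {y. {v, y} \<in> edges G}"
proof (rule finite_subset)
  show "{y. {v, y} \<in> edges G} \<subseteq> verts G" using edge_verts[OF assms] by blast
  show "finite (verts G)" using assms by (simp add: finite_simple_graph_def)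
qed

lemma degree_le_max_degree:
  assumes "finite_simple_graph G" "v \<in> verts G"
  shows "degree G v \<le> max_degree G"
  using assms by (simp add: max_degree_def finite_simple_graph_def)

section \<open>Back to graph triples\<close>
definition pulled_back :: "'b set \<Rightarrow> ('b \<Rightarrow> 'a) \<Rightarrow> 'a graph \<Rightarrow> 'b \<Rightarrow> 'b \<Rightarrow> bool" where
  "pulled_back V g G x y \<longleftrightarrow> x \<in> V \<and> y \<in> V \<and> {g x, g y} \<in> edges G"

lemma card_pulled_back:
  assumes G: "finite_simple_graph G" and g: "bij_betw g V (verts G)" and x: "x \<in> V"
  shows "card {y. pulled_back V g G x y} = degree G (g x)"
proof -
  have "g ` {y. pulled_back V g G x y} = {y. {g x, y} \<in> edges G}"
  proof (rule equalityI; rule subsetI)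
    fix y assume y: "y \<in> {y. {g x, y} \<in> edges G}"
    then have "y \<in> g ` V" using edge_verts(2)[OF G] g by (auto simp: bij_betw_def)
    then show "y \<in> g ` {y. pulled_back V g G x y}" using x y by (auto simp: pulled_back_def)
  qed (auto simp: pulled_back_def)
  moreover have "inj_on g {y. pulled_back V g G x y}"
    using g by (auto simp: bij_betw_def pulled_back_def inj_on_def)
  ultimately show ?thesis unfolding degree_eq_card_nbrs[OF G] by (metis card_image)
qed

lemma extremal_pair_of_relations:
  assumes G: "finite_simple_graph G" "bij_betw g V (verts G)"
    and H: "finite_simple_graph H" "bij_betw h V (verts H)"
    and ext: "extremal_relations V (n div 2) (pulled_back V g G) (pulled_back V h H)"
  shows "extremal_pair n G H"
proof -
  have hV: "verts H = h ` V" and inj: "inj_on h V" using H(2) by (auto simp: bij_betw_def)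
  have "degree G v = 1" if "v \<in> verts G" for v
  proof -
    obtain x where "x \<in> V" "v = g x" using G(2) \<open>v \<in> verts G\<close> by (auto simp: bij_betw_def)
    then show ?thesis using ext card_pulled_back[OF G] by (auto simp: extremal_relations_def)
  qed
  then have pm: "is_perfect_matching G" by (simp add: is_perfect_matching_def)
  from ext consider
    (bip) X Z where "V = X \<union> Z" "X \<inter> Z = {}" "card X = n div 2" "card Z = n div 2" "odd (n div 2)"
      "\<And>x y. pulled_back V h H x y \<longleftrightarrow> x \<in> X \<and> y \<in> Z \<or> x \<in> Z \<and> y \<in> X"
    | (clique) K where "K \<subseteq> V" "card K = n div 2 + 1"
      "\<And>x y. x \<in> K \<Longrightarrow> y \<in> K \<Longrightarrow> x \<noteq> y \<Longrightarrow> pulled_back V h H x y"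
    unfolding extremal_relations_def by blast
  then have "is_complete_bipartite (n div 2) (n div 2) H \<and> odd (n div 2) \<or>
      contains_complete (n div 2 + 1) H"
  proof cases
    case bip
    have inj': "inj_on h X" "inj_on h Z" using inj bip(1) by (auto intro: inj_on_subset)
    have "edges H = {{a, b} | a b. a \<in> h ` X \<and> b \<in> h ` Z}"
    proof (rule equalityI; rule subsetI)
      fix e assume e: "e \<in> edges H"
      then have "card e = 2" "e \<subseteq> h ` V" using H(1) hV by (auto simp: finite_simple_graph_def)
      then obtain x y where xy: "e = {h x, h y}" "x \<in> V" "y \<in> V" by (auto simp: card_2_iff)
      then have "pulled_back V h H x y" using e by (simp add: pulled_back_def)
      then consider "x \<in> X" "y \<in> Z" | "x \<in> Z" "y \<in> X" using bip(6) by blast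
      then show "e \<in> {{a, b} | a b. a \<in> h ` X \<and> b \<in> h ` Z}"
      proof cases
        case 1
        then show ?thesis using xy by blast
      next
        case 2
        then have "e = {h y, h x}" "h y \<in> h ` X" "h x \<in> h ` Z" using xy by auto
        then show ?thesis by blast
      qed
    next
      fix e assume "e \<in> {{a, b} | a b. a \<in> h ` X \<and> b \<in> h ` Z}"
      then obtain x y where "e = {h x, h y}" "x \<in> X" "y \<in> Z" by blast
      then show "e \<in> edges H" using bip(6)[of x y] by (simp add: pulled_back_def)
    qed
    moreover have "verts H = h ` X \<union> h ` Z" "h ` X \<inter> h ` Z = {}"
      using hV bip(1,2) inj by (auto simp: inj_on_def)
    moreover have "card (h ` X) = n div 2" "card (h ` Z) = n div 2"
      using card_image[OF inj'(1)] card_image[OF inj'(2)] bip(3,4) by simp_all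
    ultimately have "is_complete_bipartite (n div 2) (n div 2) H"
      unfolding is_complete_bipartite_def by (intro exI[of _ "h ` X"] exI[of _ "h ` Z"] conjI)
    then show ?thesis using bip(5) by blast
  next
    case clique
    have "card (h ` K) = n div 2 + 1"
      using clique(1,2) inj by (metis card_image inj_on_subset)
    moreover have "h ` K \<subseteq> verts H" using clique(1) hV by blast
    moreover have "\<forall>u\<in>h ` K. \<forall>v\<in>h ` K. u \<noteq> v \<longrightarrow> {u, v} \<in> edges H"
      using clique(3) by (auto simp: pulled_back_def)
    ultimately show ?thesis unfolding contains_complete_def by blast
  qed
  then show ?thesis using pm by (simp add: extremal_pair_def)
qed

text \<open>The inverse bijection; its condition on \<open>G3\<close> is unchanged because edges are unordered.\<close>
lemma packs_sym:
  assumes "packs G1 G2 G3"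
  shows "packs G2 G1 G3"
proof -
  obtain f where f: "bij_betw f (verts G1) (verts G2)"
    and e: "\<And>u v. u \<in> verts G1 \<Longrightarrow> v \<in> verts G1 \<Longrightarrow> {u, v} \<in> edges G1 \<Longrightarrow> {f u, f v} \<notin> edges G2"
    and l: "\<And>u. u \<in> verts G1 \<Longrightarrow> {u, f u} \<notin> edges G3"
    using assms unfolding packs_def by blast
  let ?g = "inv_into (verts G1) f"
  have g: "bij_betw ?g (verts G2) (verts G1)" by (rule bij_betw_inv_into[OF f])
  have gV: "?g x \<in> verts G1" "f (?g x) = x" if "x \<in> verts G2" for x
    using that bij_betwE[OF g] bij_betw_inv_into_right[OF f] by auto
  show ?thesis unfolding packs_def
  proof (intro exI[of _ ?g] conjI g ballI impI)
    fix u v assume "u \<in> verts G2" "v \<in> verts G2" "{u, v} \<in> edges G2"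
    then show "{?g u, ?g v} \<notin> edges G1" using e[of "?g u" "?g v"] gV by auto
  next
    fix u assume "u \<in> verts G2"
    then show "{u, ?g u} \<notin> edges G3" using l[of "?g u"] gV by (simp add: insert_commute)
  qed
qed

text \<open>A packing takes some vertex set \<open>I\<close> to a side of the complete bipartite graph or to the clique. In
  the first case the matching edges at \<open>I\<close> cannot leave \<open>I\<close>, so \<open>I\<close> has even size. In the second case they
  all leave \<open>I\<close>, so at most half of the vertices lie in \<open>I\<close>.\<close>
lemma extremal_pair_not_packs:
  assumes G1: "finite_simple_graph G1" and G2: "finite_simple_graph G2"
    and n: "card (verts G1) = n" and ext: "extremal_pair n G1 G2"
  shows "\<not> packs G1 G2 G3"
proof
  assume "packs G1 G2 G3"
  then obtain f where f: "bij_betw f (verts G1) (verts G2)"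
    and e: "\<And>u v. u \<in> verts G1 \<Longrightarrow> v \<in> verts G1 \<Longrightarrow> {u, v} \<in> edges G1 \<Longrightarrow> {f u, f v} \<notin> edges G2"
    unfolding packs_def by blast
  let ?V = "verts G1"
  have fin: "finite ?V" using G1 by (simp add: finite_simple_graph_def)
  have fV: "f ` ?V = verts G2" and inj: "inj_on f ?V" using f by (auto simp: bij_betw_def)
  have pm: "card {y. {x, y} \<in> edges G1} = 1" if "x \<in> ?V" for x
    using ext that degree_eq_card_nbrs[OF G1] by (simp add: extremal_pair_def is_perfect_matching_def)
  have mate: "\<exists>y. {x, y} \<in> edges G1" if x: "x \<in> ?V" for x
    using card_1_singletonE[OF pm[OF x]] by blast
  have uniq: "y = z" if xyz: "{x, y} \<in> edges G1" "{x, z} \<in> edges G1" for x y z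
  proof -
    have "x \<in> ?V" using edge_verts(1)[OF G1 xyz(1)] .
    then obtain a where "{y. {x, y} \<in> edges G1} = {a}" using card_1_singletonE[OF pm] by blast
    then have "y \<in> {a}" "z \<in> {a}" using xyz by blast+
    then show ?thesis by simp
  qed
  have pre: "\<exists>I\<subseteq>?V. f ` I = A \<and> card I = card A" if A: "A \<subseteq> verts G2" for A
  proof -
    obtain I where I: "I \<subseteq> ?V" "A = f ` I" using A fV by (metis subset_image_iff)
    then show ?thesis using inj by (metis card_image inj_on_subset)
  qed
  have "is_complete_bipartite (n div 2) (n div 2) G2 \<and> odd (n div 2) \<or>
      contains_complete (n div 2 + 1) G2"
    using ext by (simp add: extremal_pair_def)
  then show False
  proof
    assume "is_complete_bipartite (n div 2) (n div 2) G2 \<and> odd (n div 2)"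
    then obtain A B where AB: "verts G2 = A \<union> B" "A \<inter> B = {}" "card A = n div 2" "odd (n div 2)"
      "edges G2 = {{a, b} | a b. a \<in> A \<and> b \<in> B}"
      unfolding is_complete_bipartite_def by auto
    obtain I where I: "I \<subseteq> ?V" "f ` I = A" "card I = card A" using pre[of A] AB(1) by auto
    have "even (card I)"
    proof (rule even_card_matched[where R = "\<lambda>x y. {x, y} \<in> edges G1"])
      show "finite I" using I(1) fin by (rule finite_subset)
      show "{y, x} \<in> edges G1" if "{x, y} \<in> edges G1" for x y
        using that by (simp add: insert_commute)
      show "{x, x} \<notin> edges G1" for x using edge_verts(3)[OF G1] by blast
      show "y = z" if "{x, y} \<in> edges G1" "{x, z} \<in> edges G1" for x y z
        using uniq that .
      fix x assume x: "x \<in> I"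
      then have xV: "x \<in> ?V" using I(1) by blast
      obtain y where y: "{x, y} \<in> edges G1" using mate[OF xV] by blast
      have yV: "y \<in> ?V" using edge_verts(2)[OF G1 y] .
      have "f y \<notin> B" using e[OF xV yV y] x I(2) AB(5) by blast
      then have "f y \<in> f ` I" using yV fV AB(1) I(2) by blast
      then have "y \<in> I" using inj_on_image_mem_iff[OF inj yV I(1)] by blast
      then show "\<exists>y\<in>I. {x, y} \<in> edges G1" using y by blast
    qed
    then show False using I(3) AB(3,4) by simp
  next
    assume "contains_complete (n div 2 + 1) G2"
    then obtain K where K: "K \<subseteq> verts G2" "card K = n div 2 + 1"
      "\<And>u v. u \<in> K \<Longrightarrow> v \<in> K \<Longrightarrow> u \<noteq> v \<Longrightarrow> {u, v} \<in> edges G2"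
      unfolding contains_complete_def by blast
    obtain I where I: "I \<subseteq> ?V" "f ` I = K" "card I = card K" using pre[OF K(1)] by blast
    obtain m where m: "\<And>x. x \<in> ?V \<Longrightarrow> {x, m x} \<in> edges G1" using mate by metis
    have "m x \<in> ?V - I" if x: "x \<in> I" for x
    proof -
      have xV: "x \<in> ?V" using x I(1) by blast
      have mV: "m x \<in> ?V" "x \<noteq> m x" using edge_verts[OF G1 m[OF xV]] by auto
      have "f x \<noteq> f (m x)" using inj xV mV by (auto simp: inj_on_def)
      then have "m x \<notin> I" using K(3)[of "f x" "f (m x)"] e[OF xV mV(1) m[OF xV]] x I(2) by blast
      then show ?thesis using mV by blast
    qed
    moreover have "inj_on m I"
    proof (rule inj_onI)
      fix x y assume "x \<in> I" "y \<in> I" "m x = m y"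
      then show "x = y" using uniq[of "m x" x y] m[of x] m[of y] I(1) by (auto simp: insert_commute)
    qed
    ultimately have "card I \<le> card (?V - I)" using fin by (intro card_inj_on_le[of m]) auto
    also have "\<dots> = n - card I" using I(1) fin n by (simp add: card_Diff_subset finite_subset)
    finally show False using I(3) K(2) by linarith
  qed
qed

text \<open>An optimal overlay arises from a bijection of least overlap. As it is not a packing and an optimal
  overlay has no loop, it has a double edge.\<close>
lemma not_packs_extremal:
  fixes G1 G2 G3 :: "'a graph"
  assumes triple: "graph_triple n G1 G2 G3"
    and le: "2 * (max_degree G1 * max_degree G2 + max_degree G3) \<le> n"
    and np: "\<not> packs G1 G2 G3"
  shows "max_degree G3 = 0 \<and> n = 2 * (max_degree G1 * max_degree G2) \<and>
    (extremal_pair n G1 G2 \<or> extremal_pair n G2 G1)"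
proof -
  have G: "finite_simple_graph G1" "finite_simple_graph G2" "finite_simple_graph G3"
    and n: "card (verts G1) = n" "card (verts G2) = n" and V3: "verts G3 = verts G1 \<union> verts G2"
    using triple by (auto simp: graph_triple_def bipartite_with_def)
  let ?V = "verts G1"
  have fin: "finite ?V" "finite (verts G2)" using G by (auto simp: finite_simple_graph_def)
  define R where "R = pulled_back ?V id G1"
  define B where "B f = pulled_back ?V f G2" for f
  define Y where "Y f x y \<longleftrightarrow> x \<in> ?V \<and> y \<in> ?V \<and> {x, f y} \<in> edges G3" for f x y
  have idb: "bij_betw id ?V ?V" by simp
  obtain f0 where "bij_betw f0 ?V (verts G2)"
    using finite_same_card_bij[OF fin] n by auto
  then obtain f where f: "bij_betw f ?V (verts G2)"
    and least: "\<And>g. bij_betw g ?V (verts G2) \<Longrightarrow> overlap ?V R (B f) (Y f) \<le> overlap ?V R (B g) (Y g)"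
    using ex_has_least_nat[of "\<lambda>f. bij_betw f ?V (verts G2)" f0 "\<lambda>f. overlap ?V R (B f) (Y f)"]
    by blast
  have fV: "f x \<in> verts G2" if "x \<in> ?V" for x using bij_betwE[OF f] that by blast
  have inj: "inj_on f ?V" using f by (simp add: bij_betw_def)
  interpret optimal_overlay ?V R "B f" "Y f" "max_degree G1" "max_degree G2" "max_degree G3"
  proof
    show "\<not> R x x" "\<not> B f x x" for x
      using edge_verts(3)[OF G(1), of x x] edge_verts(3)[OF G(2), of "f x" "f x"]
      by (auto simp: R_def B_def pulled_back_def)
    show "card {y. R x y} \<le> max_degree G1" for x
      using card_pulled_back[OF G(1) idb, of x] degree_le_max_degree[OF G(1), of x]
      by (cases "x \<in> ?V") (auto simp: R_def pulled_back_def)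
    show "card {y. B f x y} \<le> max_degree G2" for x
      using card_pulled_back[OF G(2) f, of x] degree_le_max_degree[OF G(2) fV, of x]
      by (cases "x \<in> ?V") (auto simp: B_def pulled_back_def)
    show "card {y. Y f x y} \<le> max_degree G3" for x
    proof (cases "x \<in> ?V")
      case True
      have "card {y. Y f x y} \<le> card {z. {x, z} \<in> edges G3}"
        by (rule card_inj_on_le[of f]) (use inj finite_nbrs[OF G(3)] in \<open>auto simp: Y_def inj_on_def\<close>)
      then show ?thesis
        using degree_le_max_degree[OF G(3), of x] True V3 degree_eq_card_nbrs[OF G(3), of x] by simp
    qed (simp add: Y_def)
    show "card {x. Y f x y} \<le> max_degree G3" for y
    proof (cases "y \<in> ?V")
      case True
      have "card {x. Y f x y} \<le> card {z. {f y, z} \<in> edges G3}"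
        by (rule card_mono[OF finite_nbrs[OF G(3)]]) (auto simp: Y_def insert_commute)
      then show ?thesis
        using degree_le_max_degree[OF G(3), of "f y"] True fV V3 degree_eq_card_nbrs[OF G(3), of "f y"]
        by simp
    qed (simp add: Y_def)
    show "2 * (max_degree G1 * max_degree G2 + max_degree G3) \<le> card ?V" using le n by simp
    fix p assume p: "p permutes ?V"
    have "overlap ?V R (B f) (Y f) \<le> overlap ?V R (B (f \<circ> p)) (Y (f \<circ> p))"
      by (rule least) (rule bij_betw_trans[OF permutes_imp_bij[OF p] f])
    moreover have "B (f \<circ> p) = (\<lambda>x y. B f (p x) (p y))" "Y (f \<circ> p) = (\<lambda>x y. Y f x (p y))"
      by (auto simp: B_def Y_def pulled_back_def permutes_in_image[OF p] fun_eq_iff)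
    ultimately show "overlap ?V R (B f) (Y f) \<le> overlap ?V R (\<lambda>x y. B f (p x) (p y)) (\<lambda>x y. Y f x (p y))"
      by simp
  qed (auto simp: R_def B_def Y_def pulled_back_def fin insert_commute)
  obtain u v where uv: "R u v \<and> B f u v"
  proof (rule ccontr)
    assume no: "\<not> thesis"
    note no' = that
    have "packs G1 G2 G3" unfolding packs_def
    proof (intro exI[of _ f] conjI f ballI impI notI)
      fix x y assume "x \<in> ?V" "y \<in> ?V" "{x, y} \<in> edges G1" "{f x, f y} \<in> edges G2"
      then have "R x y \<and> B f x y" by (simp add: R_def B_def pulled_back_def)
      then show False using no' no by blast
    next
      fix x assume "x \<in> ?V" "{x, f x} \<in> edges G3"
      then show False using no_loop[of x] by (simp add: Y_def)
    qed
    then show False using np by blast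
  qed
  have "extremal_pair n G1 G2 \<or> extremal_pair n G2 G1"
    using conflict_extremal[OF uv] extremal_pair_of_relations[OF G(1) idb G(2) f, of n]
      extremal_pair_of_relations[OF G(2) f G(1) idb, of n] n
    unfolding R_def B_def by blast
  then show ?thesis using conflict_extremal[OF uv] n by simp
qed

theorem theorem5:
  fixes n :: nat and G1 G2 G3 :: "'a graph"
  assumes "n > 0"
    and "graph_triple n G1 G2 G3"
  shows "(real (max_degree G1 * max_degree G2 + max_degree G3) \<le> real n / 2 \<longrightarrow>
            (\<not> packs G1 G2 G3 \<longleftrightarrow>
               max_degree G3 = 0 \<and> (extremal_pair n G1 G2 \<or> extremal_pair n G2 G1)))
       \<and> (real (max_degree G1 * max_degree G2 + max_degree G3) < real n / 2 \<longrightarrow>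
            packs G1 G2 G3)"
proof -
  let ?s = "max_degree G1 * max_degree G2 + max_degree G3"
  have le: "real s \<le> real n / 2 \<longleftrightarrow> 2 * s \<le> n" and less: "real s < real n / 2 \<longleftrightarrow> 2 * s < n" for s
    by auto
  have G: "finite_simple_graph G1" "finite_simple_graph G2" "card (verts G1) = n" "card (verts G2) = n"
    using assms(2) by (auto simp: graph_triple_def)
  have "\<not> packs G1 G2 G3" if "extremal_pair n G1 G2 \<or> extremal_pair n G2 G1"
    using that extremal_pair_not_packs[OF G(1,2,3)] extremal_pair_not_packs[OF G(2,1,4)] packs_sym
    by blast
  moreover have "packs G1 G2 G3" if "2 * ?s < n"
  proof (rule ccontr)
    assume "\<not> packs G1 G2 G3"
    then show False using not_packs_extremal[OF assms(2)] that by auto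
  qed
  ultimately show ?thesis unfolding le less using not_packs_extremal[OF assms(2)] by blast
qed

end
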